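(* For any integer $p\ge2$ and $z\in\mathbb{C}$, the internal stability polynomials of the explicit Euler extrapolation method are given by $$Q^{\mathrm{EE}}_{p,m,\ell}(z)=\frac{(-1)^{m+p}m^{p-1}}{(p-m)!\,(m-1)!}\left(1+\frac zm\right)^{m-\ell}\qquad(1\le m\le p,\ 1\le\ell\le m).$$
   Context: Explicit Euler (EE) extrapolation of order $p\ge2$ on the test equation $U'=\lambda U$, with $z=\tau\lambda\in\mathbb{C}$ and internal perturbations: given $U_n$ and residuals $\tilde r_{m,j}\in\mathbb{C}$ ($1\le m\le p$, $1\le j\le m$), set $$\widetilde Y_{m,0}=U_n,\qquad \widetilde Y_{m,j}=\Big(1+\frac zm\Big)\widetilde Y_{m,j-1}+\tilde r_{m,j}\ (1\le j\le m),\qquad T_{m,1}=\widetilde Y_{m,m},$$ $$T_{j,k}=T_{j,k-1}+\frac{T_{j,k-1}-T_{j-1,k-1}}{\frac{j}{j-k+1}-1}\quad(2\le k\le j\le p),\qquad U_{n+1}=T_{p,p}.$$ Then $U_{n+1}=P(z)U_n+\sum_{m=1}^p\sum_{\ell=1}^mQ^{\mathrm{EE}}_{p,m,\ell}(z)\,\tilde r_{m,\ell}$, which defines the internal stability polynomials $Q^{\mathrm{EE}}_{p,m,\ell}$. The convention $x^0=1$ for all $x$ (including $x=0$) is used. *)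

theory Defs
  imports Complex_Main "HOL-Computational_Algebra.Polynomial"
begin

text \<open>One step of explicit Euler extrapolation applied to \<open>U' = \<lambda> U\<close>, with \<open>z = \<tau> \<lambda>\<close>,
  starting value \<open>u\<close> (that is, \<open>U\<^sub>n\<close>) and perturbations \<open>r m j\<close>.
  Only the values \<open>r m j\<close> with \<open>1 \<le> j \<le> m\<close> are used.\<close>

primrec EE_Y :: "complex \<Rightarrow> complex \<Rightarrow> (nat \<Rightarrow> nat \<Rightarrow> complex) \<Rightarrow> nat \<Rightarrow> nat \<Rightarrow> complex" where
  "EE_Y z u r m 0 = u"
| "EE_Y z u r m (Suc j) = (1 + z / of_nat m) * EE_Y z u r m j + r m (Suc j)"

text \<open>The tableau \<open>T\<^sub>j\<^sub>,\<^sub>k\<close> is meaningful for \<open>1 \<le> k \<le> j\<close>; in that range the subtraction on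
  natural numbers does not truncate, and for \<open>k \<ge> 2\<close> the divisor is nonzero.\<close>

fun EE_T :: "complex \<Rightarrow> complex \<Rightarrow> (nat \<Rightarrow> nat \<Rightarrow> complex) \<Rightarrow> nat \<Rightarrow> nat \<Rightarrow> complex" where
  "EE_T z u r j k =
     (if k \<le> 1 then EE_Y z u r j j
      else EE_T z u r j (k - 1) +
           (EE_T z u r j (k - 1) - EE_T z u r (j - 1) (k - 1)) /
           (of_nat j / of_nat (j - k + 1) - 1))"

declare EE_T.simps [simp del]

definition EE_step :: "nat \<Rightarrow> complex \<Rightarrow> complex \<Rightarrow> (nat \<Rightarrow> nat \<Rightarrow> complex) \<Rightarrow> complex" where
  "EE_step p z u r = EE_T z u r p p"

definition EE_expansion ::
  "nat \<Rightarrow> complex poly \<Rightarrow> (nat \<Rightarrow> nat \<Rightarrow> complex poly) \<Rightarrow> bool" where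
  "EE_expansion p P Q \<longleftrightarrow>
     (\<forall>z u r. EE_step p z u r =
        poly P z * u + (\<Sum>m=1..p. \<Sum>l=1..m. poly (Q m l) z * r m l))"

text \<open>The internal stability polynomial is the coefficient of \<open>r m l\<close> in this expansion. The
  definite description is meaningful for \<open>1 \<le> l \<le> m \<le> p\<close>: the step is linear in \<open>u\<close> and \<open>r\<close>
  with coefficients polynomial in \<open>z\<close>, and the expansion determines these coefficients.\<close>

definition Q_EE :: "nat \<Rightarrow> nat \<Rightarrow> nat \<Rightarrow> complex poly" where
  "Q_EE p m l = (THE q. \<exists>P Q. EE_expansion p P Q \<and> Q m l = q)"

end

theory Submission
  imports Defs
begin

text \<open>
  With \<open>k = n + 1\<close> the divisor in the tableau is \<open>j / (j - k + 1) - 1 = n / (j - n)\<close>, so the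
  extrapolation rule is the Aitken--Neville recursion at step sizes proportional to \<open>1 / m\<close>.
  Writing \<open>Y\<^sub>m\<close> for the first column, its solution is
  \<open>T\<^bsub>s + n, n + 1\<^esub> = \<Delta>\<^sup>n (x\<^sup>n Y\<^sub>x) (s) / n!\<close>, where \<open>\<Delta>\<close> is the forward difference in the
  integer variable \<open>x\<close>: one step of the recursion is the Leibniz rule for
  \<open>\<Delta>\<^bsup>n + 1\<^esup> (x g)\<close> with \<open>g = x\<^sup>n Y\<^sub>x\<close> (\<open>forward_diff_times_argument\<close>, \<open>EE_T_eq_forward_diff\<close>).
  Expanding the difference at \<open>s = 1\<close>, \<open>n = p - 1\<close> by binomial coefficients gives the step as a
  combination of the \<open>Y\<^sub>m\<close> whose weights are the prefactors in the theorem
  (\<open>EE_step_eq_weighted_sum\<close>). In \<open>Y\<^sub>m\<close> the perturbation \<open>r m l\<close> passes through the \<open>m - l\<close>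
  remaining Euler steps, each multiplying it by \<open>1 + z / m\<close>.

  This exhibits one expansion (\<open>EE_expansion_explicit\<close>). Feeding in a single unit perturbation
  shows that its coefficients are determined (\<open>EE_expansion_unique\<close>), which evaluates the definite
  description in \<open>Q_EE\<close>.
\<close>

primrec forward_diff :: "nat \<Rightarrow> (nat \<Rightarrow> 'a::comm_ring_1) \<Rightarrow> nat \<Rightarrow> 'a" where
  "forward_diff 0 f s = f s"
| "forward_diff (Suc n) f s = forward_diff n f (Suc s) - forward_diff n f s"

text \<open>The Leibniz rule for a product with the identity function, whose differences of order two
  and more vanish, so only two terms survive. The term \<open>s * forward_diff (Suc n) f s\<close> is
  split into lower differences, because in this form the right-hand side matches one step of the
  extrapolation recursion.\<close>

lemma forward_diff_times_argument:
  "forward_diff (Suc n) (\<lambda>x. of_nat x * f x) s =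
     of_nat (s + Suc n) * forward_diff n f (Suc s) - of_nat s * forward_diff n f s"
proof (induction n arbitrary: s)
  case 0
  show ?case by simp
next
  case (Suc n)
  have "forward_diff (Suc (Suc n)) (\<lambda>x. of_nat x * f x) s =
      forward_diff (Suc n) (\<lambda>x. of_nat x * f x) (Suc s) -
      forward_diff (Suc n) (\<lambda>x. of_nat x * f x) s"
    by (rule forward_diff.simps)
  then show ?case
    unfolding Suc.IH by (simp add: algebra_simps)
qed

lemma forward_diff_binomial:
  "forward_diff n f s =
     (\<Sum>i\<le>n. (-1) ^ (n + i) * of_nat (n choose i) * f (s + i))"
proof (induction n arbitrary: s)
  case 0
  show ?case by simp
next
  case (Suc n)
  let ?g = "\<lambda>i. (-1) ^ (n + i) * f (s + i)"
  have shifted: "forward_diff n f (Suc s) =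
      - (\<Sum>i\<le>n. of_nat (n choose i) * ?g (Suc i))"
    unfolding Suc.IH by (simp add: sum_negf [symmetric] mult_ac)
  have unshifted: "forward_diff n f s = ?g 0 + (\<Sum>i\<le>n. of_nat (n choose Suc i) * ?g (Suc i))"
  proof -
    have "forward_diff n f s = (\<Sum>i\<le>Suc n. of_nat (n choose i) * ?g i)"
      unfolding Suc.IH by (simp add: mult_ac binomial_eq_0)
    also have "\<dots> = ?g 0 + (\<Sum>i\<le>n. of_nat (n choose Suc i) * ?g (Suc i))"
      by (subst sum.atMost_Suc_shift) simp
    finally show ?thesis .
  qed
  have "(\<Sum>i\<le>Suc n. (-1) ^ (Suc n + i) * of_nat (Suc n choose i) * f (s + i)) =
      - (\<Sum>i\<le>Suc n. of_nat (Suc n choose i) * ?g i)"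
    by (simp add: sum_negf [symmetric] mult_ac)
  also have "(\<Sum>i\<le>Suc n. of_nat (Suc n choose i) * ?g i) =
      ?g 0 + (\<Sum>i\<le>n. of_nat (n choose i) * ?g (Suc i)) +
      (\<Sum>i\<le>n. of_nat (n choose Suc i) * ?g (Suc i))"
    by (subst sum.atMost_Suc_shift)
      (simp only: binomial_n_0 binomial_Suc_Suc of_nat_1 mult_1 of_nat_add distrib_right
        sum.distrib add.assoc)
  finally show ?case
    using shifted unshifted by simp
qed

text \<open>The index is shifted to \<open>j = s + n\<close>, \<open>k = n + 1\<close>, so that \<open>s\<close> is the lowest row on which the
  entry depends, and \<open>1 \<le> s\<close> describes the triangle \<open>k \<le> j\<close>.\<close>

lemma EE_T_eq_forward_diff:
  assumes "1 \<le> s"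
  shows "EE_T z u r (s + n) (Suc n) =
    forward_diff n (\<lambda>x. of_nat x ^ n * EE_Y z u r x x) s / fact n"
  using assms
proof (induction n arbitrary: s)
  case 0
  show ?case by (simp add: EE_T.simps)
next
  case (Suc n)
  let ?D = "forward_diff n (\<lambda>x. of_nat x ^ n * EE_Y z u r x x)"
  have upper: "EE_T z u r (s + Suc n) (Suc n) = ?D (Suc s) / fact n"
    using Suc.IH [of "Suc s"] by simp
  have lower: "EE_T z u r (s + n) (Suc n) = ?D s / fact n"
    using Suc.IH Suc.prems by blast
  have index: "s + Suc n - Suc (Suc n) + 1 = s"
    using Suc.prems by simp
  have divisor: "of_nat (s + Suc n) / of_nat s - 1 = (of_nat (Suc n) / of_nat s :: complex)"
    using Suc.prems by (simp add: field_simps)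
  have "EE_T z u r (s + Suc n) (Suc (Suc n)) = EE_T z u r (s + Suc n) (Suc n) +
      (EE_T z u r (s + Suc n) (Suc n) - EE_T z u r (s + n) (Suc n)) /
      (of_nat (s + Suc n) / of_nat s - 1)"
    using EE_T.simps [of z u r "s + Suc n" "Suc (Suc n)"] unfolding index by simp
  also have "\<dots> = ?D (Suc s) / fact n +
      (?D (Suc s) / fact n - ?D s / fact n) / (of_nat (Suc n) / of_nat s)"
    by (simp only: upper lower divisor)
  also have "\<dots> = (of_nat (s + Suc n) * ?D (Suc s) - of_nat s * ?D s) / fact (Suc n)"
  proof -
    have "a / d + (a / d - b / d) / (c / t) = ((t + c) * a - t * b) / (c * d)"
      if "c \<noteq> 0" "d \<noteq> 0" for a b c d t :: complex
      using that by (cases "t = 0") (auto simp: field_simps)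
    from this [of "of_nat (Suc n)" "fact n"] show ?thesis
      by (simp only: of_nat_neq_0 fact_nonzero fact_Suc of_nat_add not_False_eq_True)
  qed
  also have "\<dots> = forward_diff (Suc n) (\<lambda>x. of_nat x ^ Suc n * EE_Y z u r x x) s / fact (Suc n)"
    by (simp only: forward_diff_times_argument [symmetric] power_Suc mult.assoc)
  finally show ?case .
qed

definition extrapolation_weight :: "nat \<Rightarrow> nat \<Rightarrow> complex" where
  "extrapolation_weight p m =
     (-1) ^ (m + p) * of_nat m ^ (p - 1) / (fact (p - m) * fact (m - 1))"

lemma EE_step_eq_weighted_sum:
  assumes "1 \<le> p"
  shows "EE_step p z u r = (\<Sum>m=1..p. extrapolation_weight p m * EE_Y z u r m m)"
proof -
  obtain n where p: "p = Suc n"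
    using assms by (cases p) auto
  have "EE_step p z u r = forward_diff n (\<lambda>x. of_nat x ^ n * EE_Y z u r x x) 1 / fact n"
    using EE_T_eq_forward_diff [of 1 z u r n] by (simp add: EE_step_def p)
  also have "\<dots> = (\<Sum>i\<le>n. extrapolation_weight p (Suc i) * EE_Y z u r (Suc i) (Suc i))"
    unfolding forward_diff_binomial sum_divide_distrib
  proof (rule sum.cong [OF refl])
    fix i assume "i \<in> {..n}"
    then have binomial: "of_nat (n choose i) / fact n = (1 / (fact i * fact (n - i)) :: complex)"
      by (simp add: binomial_fact)
    let ?c = "(-1) ^ (n + i) * (of_nat (1 + i) ^ n * EE_Y z u r (1 + i) (1 + i))"
    have "(-1) ^ (n + i) * of_nat (n choose i) *
        (of_nat (1 + i) ^ n * EE_Y z u r (1 + i) (1 + i)) / fact n =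
        ?c * (of_nat (n choose i) / fact n)"
      by (simp add: mult_ac del: EE_Y.simps)
    also have "\<dots> = ?c / (fact i * fact (n - i))"
      by (simp only: binomial times_divide_eq_right mult_1_right)
    also have "\<dots> = extrapolation_weight p (Suc i) * EE_Y z u r (Suc i) (Suc i)"
      by (simp add: extrapolation_weight_def p mult_ac add_ac del: EE_Y.simps)
    finally show "(-1) ^ (n + i) * of_nat (n choose i) *
        (of_nat (1 + i) ^ n * EE_Y z u r (1 + i) (1 + i)) / fact n =
        extrapolation_weight p (Suc i) * EE_Y z u r (Suc i) (Suc i)" .
  qed
  also have "\<dots> = (\<Sum>m=1..p. extrapolation_weight p m * EE_Y z u r m m)"
    by (simp only: p One_nat_def sum.atLeast_Suc_atMost_Suc_shift atLeast0AtMost o_def)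
  finally show ?thesis .
qed

lemma EE_Y_closed_form:
  "EE_Y z u r m j = (1 + z / of_nat m) ^ j * u +
     (\<Sum>l=1..j. (1 + z / of_nat m) ^ (j - l) * r m l)"
proof (induction j)
  case 0
  show ?case by simp
next
  case (Suc j)
  have "(\<Sum>l=1..j. (1 + z / of_nat m) ^ (Suc j - l) * r m l) =
      (1 + z / of_nat m) * (\<Sum>l=1..j. (1 + z / of_nat m) ^ (j - l) * r m l)"
    unfolding sum_distrib_left by (rule sum.cong) (auto simp: Suc_diff_le)
  then show ?case
    by (simp add: Suc.IH distrib_left)
qed

definition Euler_factor :: "nat \<Rightarrow> complex poly" where
  "Euler_factor m = [:1, 1 / of_nat m:]"

lemma poly_Euler_factor: "poly (Euler_factor m) z = 1 + z / of_nat m"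
  by (simp add: Euler_factor_def)

lemma EE_expansion_explicit:
  assumes "1 \<le> p"
  shows "EE_expansion p
    (\<Sum>m=1..p. smult (extrapolation_weight p m) (Euler_factor m ^ m))
    (\<lambda>m l. smult (extrapolation_weight p m) (Euler_factor m ^ (m - l)))"
  unfolding EE_expansion_def EE_step_eq_weighted_sum [OF assms] EE_Y_closed_form
  by (simp add: poly_sum poly_power poly_Euler_factor distrib_left sum.distrib
      sum_distrib_left sum_distrib_right mult.assoc)

text \<open>With \<open>u = 0\<close> and a single unit perturbation in position \<open>(m, l)\<close>, the step returns the value
  of the coefficient at \<open>z\<close>. The values for all \<open>z\<close> determine the polynomial, as \<open>\<complex>\<close> is infinite.\<close>

lemma EE_expansion_unique:
  assumes "EE_expansion p P Q" and "EE_expansion p P' Q'"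
    and "m \<in> {1..p}" and "l \<in> {1..m}"
  shows "Q m l = Q' m l"
proof -
  let ?unit = "\<lambda>m' l'. if m' = m \<and> l' = l then 1 else (0::complex)"
  have coeff: "EE_step p z 0 ?unit = poly (R m l) z" if "EE_expansion p S R" for S R z
  proof -
    have "EE_step p z 0 ?unit =
        (\<Sum>m'=1..p. \<Sum>l'=1..m'. poly (R m' l') z * ?unit m' l')"
      using that by (simp add: EE_expansion_def)
    also have "\<dots> = (\<Sum>m'=1..p. if m' = m then \<Sum>l'=1..m. poly (R m l') z * ?unit m l' else 0)"
      by (intro sum.cong) auto
    also have "\<dots> = (\<Sum>l'=1..m. if l' = l then poly (R m l') z else 0)"
      using assms(3) by (simp add: if_distrib cong: if_cong)
    also have "\<dots> = poly (R m l) z"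
      using assms(4) by simp
    finally show ?thesis .
  qed
  have "poly (Q m l) = poly (Q' m l)"
    using coeff [OF assms(1)] coeff [OF assms(2)] by (intro ext) metis
  then show ?thesis
    by (simp add: poly_eq_poly_eq_iff)
qed

theorem lemma4p4:
  fixes p m l :: nat and z :: complex
  assumes "2 \<le> p" and "1 \<le> m" and "m \<le> p" and "1 \<le> l" and "l \<le> m"
  shows "poly (Q_EE p m l) z =
           (-1) ^ (m + p) * of_nat m ^ (p - 1) / (fact (p - m) * fact (m - 1)) *
           (1 + z / of_nat m) ^ (m - l)"
proof -
  have exists: "EE_expansion p
      (\<Sum>m=1..p. smult (extrapolation_weight p m) (Euler_factor m ^ m))
      (\<lambda>m l. smult (extrapolation_weight p m) (Euler_factor m ^ (m - l)))"
    using assms by (intro EE_expansion_explicit) simp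
  have "Q_EE p m l = smult (extrapolation_weight p m) (Euler_factor m ^ (m - l))"
    unfolding Q_EE_def
  proof (rule the_equality)
    show "\<exists>P Q. EE_expansion p P Q \<and>
        Q m l = smult (extrapolation_weight p m) (Euler_factor m ^ (m - l))"
      using exists by blast
  next
    fix q assume "\<exists>P Q. EE_expansion p P Q \<and> Q m l = q"
    then show "q = smult (extrapolation_weight p m) (Euler_factor m ^ (m - l))"
      using EE_expansion_unique [OF _ exists, of _ _ m l] assms by auto
  qed
  then show ?thesis
    by (simp add: poly_power poly_Euler_factor extrapolation_weight_def)
qed

end
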